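(* Let $M=(M_n)_{n\in\mathbb{N}}$ be a discrete-time normal martingale with the chaotic representation property, and let $\Phi\in\mathcal{S}^*(M)$. Then there exist constants $C\ge0$ and $p\ge0$ such that $$|\widehat{\Phi}(\sigma)|\le C\lambda_\sigma^p,\quad \sigma\in\Gamma,$$ where $\widehat{\Phi}$ is the Fock transform of $\Phi$.
   Context: $\mathbb{N}$ is the set of nonnegative integers and $\Gamma$ is the (countably infinite) set of all finite subsets of $\mathbb{N}$. $(\Omega,\mathcal{F},P)$ is a probability space; $\langle\cdot,\cdot\rangle$ and $\|\cdot\|$ are the inner product (conjugate-linear in the first argument, linear in the second) and norm of the Hilbert space $\mathcal{L}^2(\Omega,\mathcal{F},P)$ of complex-valued square integrable functions. A real-valued square integrable process $M=(M_n)_{n\in\mathbb{N}}$ on $(\Omega,\mathcal{F},P)$ is a discrete-time normal martingale if, with $\mathcal{F}_{-1}=\{\emptyset,\Omega\}$ and $\mathcal{F}_n=\sigma(M_k;0\le k\le n)$: (i) $\mathbb{E}[M_0|\mathcal{F}_{-1}]=0$ and $\mathbb{E}[M_n|\mathcal{F}_{n-1}]=M_{n-1}$ for $n\ge1$; (ii) $\mathbb{E}[M_0^2|\mathcal{F}_{-1}]=1$ and $\mathbb{E}[M_n^2|\mathcal{F}_{n-1}]=M_{n-1}^2+1$ for $n\ge1$. Put $Z_0=M_0$, $Z_n=M_n-M_{n-1}$ for $n\ge1$, $Z_\emptyset=1$, and $Z_\sigma=\prod_{i\in\sigma}Z_i$ for nonempty $\sigma\in\Gamma$; $\{Z_\sigma\mid\sigma\in\Gamma\}$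 is an orthonormal system in $\mathcal{L}^2(\Omega,\mathcal{F},P)$. Let $\mathcal{F}_\infty=\sigma(M_n;n\in\mathbb{N})$ and $\mathcal{L}^2(M)=\mathcal{L}^2(\Omega,\mathcal{F}_\infty,P)$. $M$ has the chaotic representation property if $\{Z_\sigma\mid\sigma\in\Gamma\}$ is total in $\mathcal{L}^2(M)$ (hence an orthonormal basis of it). Let $\lambda_\emptyset=1$ and $\lambda_\sigma=\prod_{k\in\sigma}(k+1)$ for nonempty $\sigma\in\Gamma$. For $p\ge0$ put $\|\xi\|_p^2=\sum_{\sigma\in\Gamma}\lambda_\sigma^{2p}|\langle Z_\sigma,\xi\rangle|^2$ for $\xi\in\mathcal{L}^2(M)$, and $\mathcal{S}_p(M)=\{\xi\in\mathcal{L}^2(M)\mid\|\xi\|_p<\infty\}$, a Hilbert space with norm $\|\cdot\|_p$. Let $\mathcal{S}(M)=\bigcap_{p=0}^\infty\mathcal{S}_p(M)$ with the topology generated by the norms $\{\|\cdot\|_p\}_{p\ge0}$; all $Z_\sigma$ belong to $\mathcal{S}(M)$. $\mathcal{S}^*(M)$ is the dual of $\mathcal{S}(M)$ (continuous linear functionals); its elements are called generalized functionals of $M$. The Fock transform of $\Phi\in\mathcal{S}^*(M)$ is the function $\widehat{\Phi}$ on $\Gamma$ given by $\widehat{\Phi}(\sigma)=\Phi(Z_\sigma)$, $\sigma\in\Gamma$. *)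

theory Defs
  imports "HOL-Probability.Probability"
begin

section \<open>Discrete-time normal martingales\<close>

definition gen_algebra :: "'a measure \<Rightarrow> (nat \<Rightarrow> 'a \<Rightarrow> real) \<Rightarrow> nat set \<Rightarrow> 'a measure" where
  "gen_algebra P M I =
     sigma (space P) (\<Union>k\<in>I. {M k -` A \<inter> space P | A. A \<in> sets borel})"

text \<open>\<open>gen_algebra P M I\<close> is the \<open>\<sigma>\<close>-algebra generated by the \<open>M k\<close> with \<open>k \<in> I\<close>. Thus
  \<open>gen_algebra P M {0..n}\<close> is \<open>F\<^sub>n\<close>, and the trivial \<open>\<sigma>\<close>-algebra with index \<open>-1\<close> is
  \<open>gen_algebra P M {}\<close>.\<close>

definition normal_martingale :: "'a measure \<Rightarrow> (nat \<Rightarrow> 'a \<Rightarrow> real) \<Rightarrow> bool" where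
  "normal_martingale P M \<longleftrightarrow>
     (\<forall>n. M n \<in> borel_measurable P \<and> integrable P (\<lambda>\<omega>. (M n \<omega>)\<^sup>2)) \<and>
     (AE \<omega> in P. real_cond_exp P (gen_algebra P M {}) (M 0) \<omega> = 0) \<and>
     (\<forall>n\<ge>1. AE \<omega> in P.
        real_cond_exp P (gen_algebra P M {0..n - 1}) (M n) \<omega> = M (n - 1) \<omega>) \<and>
     (AE \<omega> in P. real_cond_exp P (gen_algebra P M {}) (\<lambda>x. (M 0 x)\<^sup>2) \<omega> = 1) \<and>
     (\<forall>n\<ge>1. AE \<omega> in P.
        real_cond_exp P (gen_algebra P M {0..n - 1}) (\<lambda>x. (M n x)\<^sup>2) \<omega> = (M (n - 1) \<omega>)\<^sup>2 + 1)"

definition Gam :: "nat set set" where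
  "Gam = {\<sigma>. finite \<sigma>}"

definition Znoise :: "(nat \<Rightarrow> 'a \<Rightarrow> real) \<Rightarrow> nat \<Rightarrow> 'a \<Rightarrow> real" where
  "Znoise M n \<omega> = (if n = 0 then M 0 \<omega> else M n \<omega> - M (n - 1) \<omega>)"

definition Zprod :: "(nat \<Rightarrow> 'a \<Rightarrow> real) \<Rightarrow> nat set \<Rightarrow> 'a \<Rightarrow> complex" where
  "Zprod M \<sigma> \<omega> = complex_of_real (\<Prod>i\<in>\<sigma>. Znoise M i \<omega>)"


section \<open>Square integrable functionals\<close>

text \<open>Elements of \<open>L\<^sup>2\<close> are represented by square integrable functions; identification of almost
  everywhere equal functions is imposed on the functionals (see \<open>SM_dual\<close>).\<close>

definition L2_space :: "'a measure \<Rightarrow> ('a \<Rightarrow> complex) set" where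
  "L2_space N = {\<xi>. \<xi> \<in> borel_measurable N \<and> integrable N (\<lambda>\<omega>. (cmod (\<xi> \<omega>))\<^sup>2)}"

definition L2_inner :: "'a measure \<Rightarrow> ('a \<Rightarrow> complex) \<Rightarrow> ('a \<Rightarrow> complex) \<Rightarrow> complex" where
  "L2_inner P \<xi> \<eta> = (\<integral>\<omega>. cnj (\<xi> \<omega>) * \<eta> \<omega> \<partial>P)"

definition L2_norm :: "'a measure \<Rightarrow> ('a \<Rightarrow> complex) \<Rightarrow> real" where
  "L2_norm P \<xi> = sqrt (\<integral>\<omega>. (cmod (\<xi> \<omega>))\<^sup>2 \<partial>P)"

definition L2M :: "'a measure \<Rightarrow> (nat \<Rightarrow> 'a \<Rightarrow> real) \<Rightarrow> ('a \<Rightarrow> complex) set" where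
  "L2M P M = L2_space (restr_to_subalg P (gen_algebra P M UNIV))"

text \<open>Totality of the \<open>Zprod M \<sigma>\<close>: their linear span is dense in \<open>L2M P M\<close>.\<close>

definition chaotic_representation :: "'a measure \<Rightarrow> (nat \<Rightarrow> 'a \<Rightarrow> real) \<Rightarrow> bool" where
  "chaotic_representation P M \<longleftrightarrow>
     (\<forall>\<xi>\<in>L2M P M. \<forall>\<epsilon>>0. \<exists>S c. finite S \<and> S \<subseteq> Gam \<and>
        L2_norm P (\<lambda>\<omega>. \<xi> \<omega> - (\<Sum>\<sigma>\<in>S. c \<sigma> * Zprod M \<sigma> \<omega>)) < \<epsilon>)"


section \<open>Testing and generalized functionals\<close>

definition lam :: "nat set \<Rightarrow> real" where
  "lam \<sigma> = (\<Prod>k\<in>\<sigma>. real (k + 1))"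

definition Sp_term ::
    "'a measure \<Rightarrow> (nat \<Rightarrow> 'a \<Rightarrow> real) \<Rightarrow> real \<Rightarrow> ('a \<Rightarrow> complex) \<Rightarrow> nat set \<Rightarrow> real" where
  "Sp_term P M p \<xi> \<sigma> = lam \<sigma> powr (2 * p) * (cmod (L2_inner P (Zprod M \<sigma>) \<xi>))\<^sup>2"

text \<open>The terms are nonnegative, so \<open>\<parallel>\<xi>\<parallel>\<^sub>p < \<infinity>\<close> means that they are summable.
  Outside \<open>Sp_space\<close> the value of \<open>Sp_norm\<close> is meaningless.\<close>

definition Sp_space :: "'a measure \<Rightarrow> (nat \<Rightarrow> 'a \<Rightarrow> real) \<Rightarrow> real \<Rightarrow> ('a \<Rightarrow> complex) set" where
  "Sp_space P M p = {\<xi> \<in> L2M P M. Sp_term P M p \<xi> summable_on Gam}"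

definition Sp_norm :: "'a measure \<Rightarrow> (nat \<Rightarrow> 'a \<Rightarrow> real) \<Rightarrow> real \<Rightarrow> ('a \<Rightarrow> complex) \<Rightarrow> real" where
  "Sp_norm P M p \<xi> = sqrt (\<Sum>\<^sub>\<infinity>\<sigma>\<in>Gam. Sp_term P M p \<xi> \<sigma>)"

definition SM_space :: "'a measure \<Rightarrow> (nat \<Rightarrow> 'a \<Rightarrow> real) \<Rightarrow> ('a \<Rightarrow> complex) set" where
  "SM_space P M = (\<Inter>p::nat. Sp_space P M (real p))"

definition SM_topology ::
    "'a measure \<Rightarrow> (nat \<Rightarrow> 'a \<Rightarrow> real) \<Rightarrow> ('a \<Rightarrow> complex) topology" where
  "SM_topology P M = topology_generated_by
     {{\<eta> \<in> SM_space P M. Sp_norm P M p (\<lambda>\<omega>. \<eta> \<omega> - \<xi> \<omega>) < \<epsilon>} | \<xi> p \<epsilon>.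
        \<xi> \<in> SM_space P M \<and> p \<ge> 0 \<and> \<epsilon> > 0}"

text \<open>The first condition says that the functional is defined on classes of almost everywhere equal
  functions. Values outside \<open>SM_space P M\<close> are irrelevant.\<close>

definition SM_dual ::
    "'a measure \<Rightarrow> (nat \<Rightarrow> 'a \<Rightarrow> real) \<Rightarrow> (('a \<Rightarrow> complex) \<Rightarrow> complex) set" where
  "SM_dual P M = {\<Phi>.
     (\<forall>\<xi>\<in>SM_space P M. \<forall>\<eta>\<in>SM_space P M. (AE \<omega> in P. \<xi> \<omega> = \<eta> \<omega>) \<longrightarrow> \<Phi> \<xi> = \<Phi> \<eta>) \<and>
     (\<forall>\<xi>\<in>SM_space P M. \<forall>\<eta>\<in>SM_space P M. \<Phi> (\<lambda>\<omega>. \<xi> \<omega> + \<eta> \<omega>) = \<Phi> \<xi> + \<Phi> \<eta>) \<and>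
     (\<forall>a. \<forall>\<xi>\<in>SM_space P M. \<Phi> (\<lambda>\<omega>. a * \<xi> \<omega>) = a * \<Phi> \<xi>) \<and>
     continuous_map (SM_topology P M) euclidean \<Phi>}"

definition Fock_transform ::
    "(nat \<Rightarrow> 'a \<Rightarrow> real) \<Rightarrow> (('a \<Rightarrow> complex) \<Rightarrow> complex) \<Rightarrow> nat set \<Rightarrow> complex" where
  "Fock_transform M \<Phi> \<sigma> = \<Phi> (Zprod M \<sigma>)"

end

theory Submission
  imports Defs
begin

text \<open>
  A continuous linear functional on a space topologised by an increasing family of norms is bounded
  on a small ball of one of these norms. The bound follows by testing this on the basis vectors: the
  products \<open>Z\<^sub>\<sigma>\<close> are orthonormal, so \<open>\<parallel>Z\<^sub>\<sigma>\<parallel>\<^sub>p = \<lambda>\<^sub>\<sigma>\<^sup>p\<close>, and the multiple \<open>t Z\<^sub>\<sigma>\<close> with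
  \<open>t = s / \<lambda>\<^sub>\<sigma>\<^sup>p\<close> stays within distance \<open>s\<close> of the origin in the norm \<open>\<parallel>\<cdot>\<parallel>\<^sub>p\<close>. If that ball lies in
  \<open>{\<xi>. \<bar>\<Phi> \<xi>\<bar> < 1}\<close>, then \<open>t \<bar>\<Phi> Z\<^sub>\<sigma>\<bar> < 1\<close>, that is \<open>\<bar>\<Phi> Z\<^sub>\<sigma>\<bar> < \<lambda>\<^sub>\<sigma>\<^sup>p / s\<close>.

  Orthonormality (\<open>Zprod_orthonormal\<close>) comes from the martingale hypotheses: given the past
  before time \<open>n\<close>, the increment \<open>Z\<^sub>n\<close> has conditional mean \<open>0\<close> and its square has conditional
  mean \<open>1\<close>. Conditioning on this past removes the largest index from \<open>\<sigma>\<close> and \<open>\<tau>\<close>: the expectation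
  of \<open>Z\<^sub>\<sigma> Z\<^sub>\<tau>\<close> vanishes when the index occurs in only one of them, and is unchanged by its
  removal when it occurs in both.

  The topology is generated by balls with arbitrary centres, and a neighbourhood of the origin
  contains a finite intersection of them. A ball of centre \<open>\<xi>\<close> containing the origin also
  contains \<open>t Z\<^sub>\<sigma>\<close> for small \<open>t \<lambda>\<^sub>\<sigma>\<^sup>p\<close>, uniformly in \<open>\<sigma>\<close>, by the triangle inequality; since only
  the coefficient at \<open>\<sigma>\<close> changes, this instance (\<open>Sp_norm_scaled_Zprod_diff\<close>) reduces to the bound
  of one term of a series by the whole sum.
\<close>

section \<open>Square integrable functions and conditional expectations\<close>

lemma integrable_mult_of_square_integrable:
  fixes f g :: "'a \<Rightarrow> 'b::{real_normed_algebra, banach, second_countable_topology}"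
  assumes [measurable]: "f \<in> borel_measurable N" "g \<in> borel_measurable N"
    and "integrable N (\<lambda>x. (norm (f x))\<^sup>2)" "integrable N (\<lambda>x. (norm (g x))\<^sup>2)"
  shows "integrable N (\<lambda>x. f x * g x)"
proof (rule Bochner_Integration.integrable_bound)
  show "integrable N (\<lambda>x. (norm (f x))\<^sup>2 + (norm (g x))\<^sup>2)"
    using assms by simp
  show "(\<lambda>x. f x * g x) \<in> borel_measurable N" by measurable
  have "norm (f x * g x) \<le> (norm (f x))\<^sup>2 + (norm (g x))\<^sup>2" for x
  proof -
    have "2 * (norm (f x) * norm (g x)) \<le> (norm (f x))\<^sup>2 + (norm (g x))\<^sup>2"
      using sum_squares_bound[of "norm (f x)" "norm (g x)"] by simp
    moreover have "0 \<le> norm (f x) * norm (g x)" by simp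
    ultimately show ?thesis using norm_mult_ineq[of "f x" "g x"] by linarith
  qed
  then show "AE x in N. norm (f x * g x) \<le> norm ((norm (f x))\<^sup>2 + (norm (g x))\<^sup>2)"
    by simp
qed

text \<open>The integrability of \<open>f g\<close> is the conclusion here, so the pull-out rule for real conditional
  expectations cannot be invoked; its version for \<open>[0, \<infinity>]\<close>-valued functions makes no such demand
  and shows that the integral of \<open>f g\<close> equals that of \<open>f\<close>.\<close>

lemma (in sigma_finite_subalgebra) integrable_mult_of_cond_exp_one:
  fixes f g :: "'a \<Rightarrow> real"
  assumes [measurable]: "f \<in> borel_measurable F" "g \<in> borel_measurable M"
    and "\<And>x. 0 \<le> f x" and g0: "\<And>x. 0 \<le> g x" and "integrable M f"
    and one: "AE x in M. real_cond_exp M F g x = 1"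
  shows "integrable M (\<lambda>x. f x * g x)"
proof -
  have [measurable]: "f \<in> borel_measurable M"
    by (rule measurable_from_subalg[OF subalg assms(1)])
  have zero: "AE x in M. 0 = nn_cond_exp M F (\<lambda>_. 0) x"
    by (rule nn_cond_exp_F_meas) simp
  \<comment> \<open>\<open>enn2real\<close> sends \<open>\<infinity>\<close> to \<open>0\<close>, so the value \<open>1\<close> also excludes an infinite conditional
    expectation.\<close>
  have eq_1: "y = 1" if "enn2real y = 1" for y
    using that by (cases y) auto
  have neg: "(\<lambda>x. ennreal (- g x)) = (\<lambda>_. 0)"
    using g0 by (simp add: ennreal_neg)
  have "AE x in M. nn_cond_exp M F (\<lambda>x. ennreal (g x)) x = 1"
    using one zero
    by eventually_elim (auto simp: real_cond_exp_def neg intro: eq_1)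
  then have "(\<integral>\<^sup>+ x. ennreal (f x) * nn_cond_exp M F (\<lambda>x. ennreal (g x)) x \<partial>M) = (\<integral>\<^sup>+ x. ennreal (f x) \<partial>M)"
    by (intro nn_integral_cong_AE) auto
  moreover have "(\<integral>\<^sup>+ x. ennreal (f x) * nn_cond_exp M F (\<lambda>x. ennreal (g x)) x \<partial>M)
      = (\<integral>\<^sup>+ x. ennreal (f x) * ennreal (g x) \<partial>M)"
    by (rule nn_cond_exp_intg) measurable
  moreover have "(\<integral>\<^sup>+ x. ennreal (f x) \<partial>M) < \<infinity>"
    using assms by (simp add: integrable_iff_bounded)
  ultimately have "(\<integral>\<^sup>+ x. ennreal (f x * g x) \<partial>M) < \<infinity>"
    using assms by (simp add: ennreal_mult)
  then show ?thesis
    using assms by (auto simp: integrable_iff_bounded)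
qed

section \<open>Orthonormality of the products of the noise\<close>

lemma space_gen_algebra [simp]: "space (gen_algebra P M I) = space P"
  unfolding gen_algebra_def by (rule space_measure_of) auto

lemma sets_gen_algebra:
  "sets (gen_algebra P M I)
     = sigma_sets (space P) (\<Union>k\<in>I. {M k -` A \<inter> space P | A. A \<in> sets borel})"
  unfolding gen_algebra_def by (rule sets_measure_of) auto

lemma measurable_gen_algebra: "k \<in> I \<Longrightarrow> M k \<in> borel_measurable (gen_algebra P M I)"
  unfolding measurable_def by (auto simp: sets_gen_algebra intro: sigma_sets.Basic)

lemma Znoise_measurable:
  assumes "{..<Suc n} \<subseteq> I"
  shows "Znoise M n \<in> borel_measurable (gen_algebra P M I)"
proof -
  have "M n \<in> borel_measurable (gen_algebra P M I)"
      "M (n - 1) \<in> borel_measurable (gen_algebra P M I)"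
    using assms by (auto intro!: measurable_gen_algebra)
  then show ?thesis
    unfolding Znoise_def[abs_def] by (cases n) simp_all
qed

text \<open>The sets \<open>{..<n}\<close> index the past strictly before time \<open>n\<close>; they treat \<open>n = 0\<close>, where the past
  is trivial, together with all other times.\<close>

lemma prod_Znoise_measurable:
  assumes "\<sigma> \<subseteq> {..<n}" "{..<n} \<subseteq> I"
  shows "(\<lambda>\<omega>. \<Prod>i\<in>\<sigma>. Znoise M i \<omega>) \<in> borel_measurable (gen_algebra P M I)"
  by (intro borel_measurable_prod Znoise_measurable) (use assms in fastforce)

lemma Gam_iff_bounded: "\<sigma> \<in> Gam \<longleftrightarrow> (\<exists>n. \<sigma> \<subseteq> {..<n})"
  by (auto simp: Gam_def finite_nat_iff_bounded)

locale normal_martingale_space = prob_space P for P :: "'a measure" +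
  fixes M :: "nat \<Rightarrow> 'a \<Rightarrow> real"
  assumes normal: "normal_martingale P M"
begin

lemma M_measurable [measurable]: "M n \<in> borel_measurable P"
  and M_square_integrable: "integrable P (\<lambda>\<omega>. (M n \<omega>)\<^sup>2)"
  using normal by (auto simp: normal_martingale_def)

lemma subalgebra_gen_algebra: "subalgebra P (gen_algebra P M I)"
  by (auto simp: subalgebra_def sets_gen_algebra intro!: sets.sigma_sets_subset)

sublocale filt: finite_measure_subalgebra P "gen_algebra P M I" for I
  by unfold_locales (rule subalgebra_gen_algebra)

lemma Znoise_measurable_P [measurable]: "Znoise M n \<in> borel_measurable P"
  unfolding Znoise_def[abs_def] by (cases n) simp_all

lemma M_integrable: "integrable P (M n)"
  by (rule square_integrable_imp_integrable[OF _ M_square_integrable]) simp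

lemma M_mult_integrable: "integrable P (\<lambda>\<omega>. M m \<omega> * M n \<omega>)"
  by (rule integrable_mult_of_square_integrable) (simp_all add: M_square_integrable)

lemma cond_exp_Znoise:
  "AE \<omega> in P. real_cond_exp P (gen_algebra P M {..<n}) (Znoise M n) \<omega> = 0"
proof (cases n)
  case 0
  then show ?thesis
    using normal by (simp add: normal_martingale_def Znoise_def[abs_def])
next
  case (Suc m)
  define G where "G = gen_algebra P M {..<n}"
  have G: "G = gen_algebra P M {0..n - 1}"
    unfolding G_def using Suc by (intro arg_cong[where f="gen_algebra P M"]) auto
  have "AE \<omega> in P. real_cond_exp P G (M n) \<omega> = M m \<omega>"
    using normal Suc unfolding normal_martingale_def G
    by (auto dest: spec[of _ n])
  moreover have "AE \<omega> in P. real_cond_exp P G (M m) \<omega> = M m \<omega>"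
    unfolding G_def using Suc
    by (intro filt.real_cond_exp_F_meas M_integrable measurable_gen_algebra) auto
  moreover have "AE \<omega> in P. real_cond_exp P G (\<lambda>\<omega>. M n \<omega> - M m \<omega>) \<omega>
      = real_cond_exp P G (M n) \<omega> - real_cond_exp P G (M m) \<omega>"
    unfolding G_def by (intro filt.real_cond_exp_diff M_integrable)
  ultimately have "AE \<omega> in P. real_cond_exp P G (\<lambda>\<omega>. M n \<omega> - M m \<omega>) \<omega> = 0"
    by eventually_elim simp
  moreover have "Znoise M n = (\<lambda>\<omega>. M n \<omega> - M m \<omega>)"
    using Suc by (simp add: Znoise_def[abs_def])
  ultimately show ?thesis
    unfolding G_def by simp
qed

text \<open>For \<open>n \<ge> 1\<close>, the conditional mean of \<open>Z\<^sub>n\<^sup>2 = M\<^sub>n\<^sup>2 - 2 M\<^sub>n\<^sub>-\<^sub>1 M\<^sub>n + M\<^sub>n\<^sub>-\<^sub>1\<^sup>2\<close> is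
  \<open>(M\<^sub>n\<^sub>-\<^sub>1\<^sup>2 + 1) - 2 M\<^sub>n\<^sub>-\<^sub>1\<^sup>2 + M\<^sub>n\<^sub>-\<^sub>1\<^sup>2 = 1\<close>, because \<open>M\<^sub>n\<^sub>-\<^sub>1\<close> is known at time \<open>n - 1\<close>.\<close>

lemma cond_exp_Znoise_square:
  "AE \<omega> in P. real_cond_exp P (gen_algebra P M {..<n}) (\<lambda>\<omega>. (Znoise M n \<omega>)\<^sup>2) \<omega> = 1"
proof (cases n)
  case 0
  then show ?thesis
    using normal by (simp add: normal_martingale_def Znoise_def[abs_def])
next
  case (Suc m)
  define G where "G = gen_algebra P M {..<n}"
  have G: "G = gen_algebra P M {0..n - 1}"
    unfolding G_def using Suc by (intro arg_cong[where f="gen_algebra P M"]) auto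
  have Mm: "M m \<in> borel_measurable G"
    unfolding G_def using Suc by (auto intro!: measurable_gen_algebra)
  have "AE \<omega> in P. real_cond_exp P G (M n) \<omega> = M m \<omega>"
    using normal Suc unfolding normal_martingale_def G
    by (auto dest: spec[of _ n])
  moreover have "AE \<omega> in P. real_cond_exp P G (\<lambda>\<omega>. (M n \<omega>)\<^sup>2) \<omega> = (M m \<omega>)\<^sup>2 + 1"
    using normal Suc unfolding normal_martingale_def G
    by (auto dest: spec[of _ n])
  moreover have "AE \<omega> in P. real_cond_exp P G (\<lambda>\<omega>. (-2 * M m \<omega>) * M n \<omega>) \<omega>
      = (-2 * M m \<omega>) * real_cond_exp P G (M n) \<omega>"
    unfolding G_def
    using Mm M_mult_integrable[of m n]
    by (intro filt.real_cond_exp_mult) (auto simp: G_def mult.assoc)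
  moreover have "AE \<omega> in P. real_cond_exp P G (\<lambda>\<omega>. (M m \<omega>)\<^sup>2) \<omega> = (M m \<omega>)\<^sup>2"
    using Mm unfolding G_def by (intro filt.real_cond_exp_F_meas M_square_integrable) auto
  moreover have "AE \<omega> in P. real_cond_exp P G (\<lambda>\<omega>. (M n \<omega>)\<^sup>2 + (-2 * M m \<omega>) * M n \<omega>) \<omega>
      = real_cond_exp P G (\<lambda>\<omega>. (M n \<omega>)\<^sup>2) \<omega> + real_cond_exp P G (\<lambda>\<omega>. (-2 * M m \<omega>) * M n \<omega>) \<omega>"
    unfolding G_def using M_mult_integrable[of m n]
    by (intro filt.real_cond_exp_add M_square_integrable) (auto simp: mult.assoc)
  moreover have "AE \<omega> in P.
      real_cond_exp P G (\<lambda>\<omega>. ((M n \<omega>)\<^sup>2 + (-2 * M m \<omega>) * M n \<omega>) + (M m \<omega>)\<^sup>2) \<omega>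
      = real_cond_exp P G (\<lambda>\<omega>. (M n \<omega>)\<^sup>2 + (-2 * M m \<omega>) * M n \<omega>) \<omega>
        + real_cond_exp P G (\<lambda>\<omega>. (M m \<omega>)\<^sup>2) \<omega>"
    unfolding G_def using M_mult_integrable[of m n]
    by (intro filt.real_cond_exp_add Bochner_Integration.integrable_add M_square_integrable)
       (auto simp: mult.assoc)
  ultimately have "AE \<omega> in P. real_cond_exp P G
      (\<lambda>\<omega>. ((M n \<omega>)\<^sup>2 + (-2 * M m \<omega>) * M n \<omega>) + (M m \<omega>)\<^sup>2) \<omega> = 1"
    by eventually_elim (simp add: power2_eq_square)
  moreover have "(\<lambda>\<omega>. (Znoise M n \<omega>)\<^sup>2) = (\<lambda>\<omega>. ((M n \<omega>)\<^sup>2 + (-2 * M m \<omega>) * M n \<omega>) + (M m \<omega>)\<^sup>2)"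
    using Suc by (auto simp: Znoise_def[abs_def] power2_eq_square algebra_simps)
  ultimately show ?thesis
    unfolding G_def by simp
qed

text \<open>Conditional expectations act on real functions, hence this real-valued form of \<open>Zprod\<close>.\<close>

abbreviation Zr :: "nat set \<Rightarrow> 'a \<Rightarrow> real" where
  "Zr \<sigma> \<omega> \<equiv> \<Prod>i\<in>\<sigma>. Znoise M i \<omega>"

lemma Zr_measurable [measurable]: "Zr \<sigma> \<in> borel_measurable P"
  by measurable

lemma Zr_split_last:
  assumes "n \<in> \<sigma>" "\<sigma> \<subseteq> {..<Suc n}"
  shows "Zr \<sigma> \<omega> = Zr (\<sigma> - {n}) \<omega> * Znoise M n \<omega>"
  using assms by (subst prod.remove[of \<sigma> n]) (auto intro: finite_subset)

text \<open>A product of square integrable functions need not be square integrable, so this is proved by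
  induction on the last time: the square of the last factor has conditional mean \<open>1\<close>.\<close>

lemma Zr_square_integrable:
  assumes "\<sigma> \<subseteq> {..<n}"
  shows "integrable P (\<lambda>\<omega>. (Zr \<sigma> \<omega>)\<^sup>2)"
  using assms
proof (induction n arbitrary: \<sigma>)
  case 0
  then show ?case by simp
next
  case (Suc n)
  let ?\<tau> = "\<sigma> - {n}"
  have \<tau>: "?\<tau> \<subseteq> {..<n}" using Suc.prems by auto
  note IH = Suc.IH[OF \<tau>]
  show ?case
  proof (cases "n \<in> \<sigma>")
    case True
    have m: "(\<lambda>\<omega>. (Zr ?\<tau> \<omega>)\<^sup>2) \<in> borel_measurable (gen_algebra P M {..<n})"
      by (intro borel_measurable_power prod_Znoise_measurable[OF \<tau>]) simp
    have "integrable P (\<lambda>\<omega>. (Zr ?\<tau> \<omega>)\<^sup>2 * (Znoise M n \<omega>)\<^sup>2)"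
      by (rule filt.integrable_mult_of_cond_exp_one[OF m _ _ _ IH cond_exp_Znoise_square]) auto
    then show ?thesis
      using True Suc.prems by (simp add: Zr_split_last[of n \<sigma>] power_mult_distrib)
  next
    case False
    then show ?thesis using IH by simp
  qed
qed

lemma Zr_mult_integrable:
  assumes "\<sigma> \<subseteq> {..<n}" "\<tau> \<subseteq> {..<n}"
  shows "integrable P (\<lambda>\<omega>. Zr \<sigma> \<omega> * Zr \<tau> \<omega>)"
  by (rule integrable_mult_of_square_integrable)
     (use Zr_square_integrable assms in \<open>simp_all\<close>)

text \<open>An increment at a time later than all others in the product has conditional mean \<open>0\<close> given
  these others.\<close>

lemma integral_Zr_mult_eq_0:
  assumes "\<sigma> \<subseteq> {..<Suc n}" "\<tau> \<subseteq> {..<n}" "n \<in> \<sigma>"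
  shows "(\<integral>\<omega>. Zr \<sigma> \<omega> * Zr \<tau> \<omega> \<partial>P) = 0"
proof -
  let ?f = "\<lambda>\<omega>. Zr (\<sigma> - {n}) \<omega> * Zr \<tau> \<omega>"
  have split: "Zr \<sigma> \<omega> * Zr \<tau> \<omega> = ?f \<omega> * Znoise M n \<omega>" for \<omega>
    using assms by (simp add: Zr_split_last[of n \<sigma>])
  have "?f \<in> borel_measurable (gen_algebra P M {..<n})"
    by (intro borel_measurable_times prod_Znoise_measurable[where n=n]) (use assms in auto)
  moreover have \<tau>: "\<tau> \<subseteq> {..<Suc n}"
    using assms by auto
  have "integrable P (\<lambda>\<omega>. ?f \<omega> * Znoise M n \<omega>)"
    using Zr_mult_integrable[OF assms(1) \<tau>] unfolding split .
  ultimately have "(\<integral>\<omega>. ?f \<omega> * Znoise M n \<omega> \<partial>P)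
      = (\<integral>\<omega>. ?f \<omega> * real_cond_exp P (gen_algebra P M {..<n}) (Znoise M n) \<omega> \<partial>P)"
    by (intro filt.real_cond_exp_intg(2)[symmetric]) auto
  also have "\<dots> = (\<integral>\<omega>. 0 \<partial>P)"
    by (rule integral_cong_AE) (use cond_exp_Znoise[of n] in auto)
  finally show ?thesis unfolding split by simp
qed

lemma integral_Zr_mult:
  assumes "\<sigma> \<subseteq> {..<n}" "\<tau> \<subseteq> {..<n}"
  shows "(\<integral>\<omega>. Zr \<sigma> \<omega> * Zr \<tau> \<omega> \<partial>P) = (if \<sigma> = \<tau> then 1 else 0)"
  using assms
proof (induction n arbitrary: \<sigma> \<tau>)
  case 0
  then show ?case by (simp add: prob_space)
next
  case (Suc n)
  let ?s = "\<sigma> - {n}" and ?t = "\<tau> - {n}"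
  have sub: "?s \<subseteq> {..<n}" "?t \<subseteq> {..<n}" using Suc.prems by auto
  consider "n \<in> \<sigma>" "n \<in> \<tau>" | "n \<in> \<sigma>" "n \<notin> \<tau>" | "n \<notin> \<sigma>" "n \<in> \<tau>" | "n \<notin> \<sigma>" "n \<notin> \<tau>"
    by blast
  then show ?case
  proof cases
    case 1
    let ?f = "\<lambda>\<omega>. Zr ?s \<omega> * Zr ?t \<omega>" and ?g = "\<lambda>\<omega>. (Znoise M n \<omega>)\<^sup>2"
    have split: "Zr \<sigma> \<omega> * Zr \<tau> \<omega> = ?f \<omega> * ?g \<omega>" for \<omega>
      using 1 Suc.prems by (simp add: Zr_split_last[of n \<sigma>] Zr_split_last[of n \<tau>] power2_eq_square)
    have "?f \<in> borel_measurable (gen_algebra P M {..<n})"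
      by (intro borel_measurable_times prod_Znoise_measurable[where n=n]) (use sub in auto)
    moreover have "integrable P (\<lambda>\<omega>. ?f \<omega> * ?g \<omega>)"
      using Zr_mult_integrable[OF Suc.prems] unfolding split .
    ultimately have "(\<integral>\<omega>. ?f \<omega> * ?g \<omega> \<partial>P)
        = (\<integral>\<omega>. ?f \<omega> * real_cond_exp P (gen_algebra P M {..<n}) ?g \<omega> \<partial>P)"
      by (intro filt.real_cond_exp_intg(2)[symmetric]) auto
    also have "\<dots> = (\<integral>\<omega>. ?f \<omega> \<partial>P)"
      by (rule integral_cong_AE) (use cond_exp_Znoise_square[of n] in auto)
    also have "\<dots> = (if ?s = ?t then 1 else 0)" by (rule Suc.IH[OF sub])
    also have "?s = ?t \<longleftrightarrow> \<sigma> = \<tau>" using 1 by auto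
    finally show ?thesis unfolding split .
  next
    case 2
    then have "?t = \<tau>" "\<sigma> \<noteq> \<tau>" by auto
    then show ?thesis
      using integral_Zr_mult_eq_0[of \<sigma> n \<tau>] Suc.prems(1) sub(2) 2(1) by simp
  next
    case 3
    then have "?s = \<sigma>" "\<sigma> \<noteq> \<tau>" by auto
    then have "(\<integral>\<omega>. Zr \<tau> \<omega> * Zr \<sigma> \<omega> \<partial>P) = 0"
      using integral_Zr_mult_eq_0[of \<tau> n \<sigma>] Suc.prems(2) sub(1) 3(2) by simp
    then show ?thesis
      using \<open>\<sigma> \<noteq> \<tau>\<close> by (simp add: mult.commute[of "Zr \<sigma> _"])
  next
    case 4
    then have "?s = \<sigma>" "?t = \<tau>" by auto
    then show ?thesis using Suc.IH[OF sub] by simp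
  qed
qed

lemma Zprod_orthonormal:
  assumes "\<sigma> \<in> Gam" "\<tau> \<in> Gam"
  shows "L2_inner P (Zprod M \<sigma>) (Zprod M \<tau>) = (if \<sigma> = \<tau> then 1 else 0)"
proof -
  obtain m n where mn: "\<sigma> \<subseteq> {..<m}" "\<tau> \<subseteq> {..<n}"
    using assms by (auto simp: Gam_iff_bounded)
  have "\<sigma> \<subseteq> {..<max m n}" "\<tau> \<subseteq> {..<max m n}"
    using mn by (auto simp: less_max_iff_disj)
  note eq = integral_Zr_mult[OF this]
  have "L2_inner P (Zprod M \<sigma>) (Zprod M \<tau>) = (\<integral>\<omega>. complex_of_real (Zr \<sigma> \<omega> * Zr \<tau> \<omega>) \<partial>P)"
    unfolding L2_inner_def Zprod_def by (simp only: complex_cnj_complex_of_real of_real_mult)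
  also have "\<dots> = complex_of_real (\<integral>\<omega>. Zr \<sigma> \<omega> * Zr \<tau> \<omega> \<partial>P)"
    by (rule integral_complex_of_real)
  finally show ?thesis unfolding eq by simp
qed

section \<open>Test functionals and their norms\<close>

lemma L2M_imp_L2_space:
  assumes "\<xi> \<in> L2M P M" shows "\<xi> \<in> L2_space P"
proof -
  note sub = subalgebra_gen_algebra[of UNIV]
  have "\<xi> \<in> borel_measurable P"
    using assms unfolding L2M_def L2_space_def
    by (blast intro: measurable_from_subalg[OF sub measurable_in_subalg'[OF sub]])
  moreover have "integrable P (\<lambda>\<omega>. (cmod (\<xi> \<omega>))\<^sup>2)"
    using assms unfolding L2M_def L2_space_def
    by (blast intro: integrable_from_subalg[OF sub])
  ultimately show ?thesis by (simp add: L2_space_def)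
qed

lemma Zprod_L2M:
  assumes "\<sigma> \<in> Gam" shows "Zprod M \<sigma> \<in> L2M P M"
proof -
  obtain n where n: "\<sigma> \<subseteq> {..<n}" using assms by (auto simp: Gam_iff_bounded)
  have m: "Zr \<sigma> \<in> borel_measurable (gen_algebra P M UNIV)"
    by (rule prod_Znoise_measurable[OF n]) simp
  have "(\<lambda>\<omega>. (Zr \<sigma> \<omega>)\<^sup>2) \<in> borel_measurable (gen_algebra P M UNIV)"
    using m by measurable
  from integrable_in_subalg[OF subalgebra_gen_algebra this Zr_square_integrable[OF n]]
  show ?thesis
    using measurable_in_subalg[OF subalgebra_gen_algebra m]
    unfolding L2M_def L2_space_def Zprod_def[abs_def]
    by (auto simp del: of_real_prod)
qed

lemma lam_ge_1: "1 \<le> lam \<sigma>"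
  unfolding lam_def by (rule prod_ge_1) simp

lemma L2M_scale:
  assumes "\<xi> \<in> L2M P M" shows "(\<lambda>\<omega>. c * \<xi> \<omega>) \<in> L2M P M"
  using assms unfolding L2M_def L2_space_def by (auto simp: norm_mult power_mult_distrib)

lemma L2_inner_scale_diff:
  assumes "\<rho> \<in> L2_space P" "\<eta> \<in> L2_space P" "\<xi> \<in> L2_space P"
  shows "L2_inner P \<rho> (\<lambda>\<omega>. c * \<eta> \<omega> - \<xi> \<omega>) = c * L2_inner P \<rho> \<eta> - L2_inner P \<rho> \<xi>"
proof -
  have "continuous_on UNIV cnj" by (intro continuous_intros)
  then have "(\<lambda>\<omega>. cnj (\<rho> \<omega>)) \<in> borel_measurable P"
    using assms(1) unfolding L2_space_def by (auto intro: borel_measurable_continuous_on)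
  then have int: "integrable P (\<lambda>\<omega>. cnj (\<rho> \<omega>) * \<zeta> \<omega>)" if "\<zeta> \<in> L2_space P" for \<zeta>
    using that assms(1) unfolding L2_space_def
    by (intro integrable_mult_of_square_integrable) simp_all
  have "L2_inner P \<rho> (\<lambda>\<omega>. c * \<eta> \<omega> - \<xi> \<omega>)
      = (\<integral>\<omega>. c * (cnj (\<rho> \<omega>) * \<eta> \<omega>) - cnj (\<rho> \<omega>) * \<xi> \<omega> \<partial>P)"
    unfolding L2_inner_def by (simp add: algebra_simps)
  then show ?thesis
    using int[OF assms(2)] int[OF assms(3)] by (simp add: L2_inner_def)
qed

lemma scaled_Zprod_SM:
  assumes "\<sigma> \<in> Gam" shows "(\<lambda>\<omega>. c * Zprod M \<sigma> \<omega>) \<in> SM_space P M"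
proof -
  have "L2_inner P (Zprod M \<tau>) (\<lambda>\<omega>. c * Zprod M \<sigma> \<omega>) = 0" if "\<tau> \<in> Gam" "\<tau> \<noteq> \<sigma>" for \<tau>
    using L2_inner_scale_diff[of "Zprod M \<tau>" "Zprod M \<sigma>" "\<lambda>_. 0" c] that assms
      Zprod_orthonormal[of \<tau> \<sigma>] Zprod_L2M L2M_imp_L2_space
    by (simp add: L2_inner_def L2_space_def)
  then have "{\<tau>\<in>Gam. Sp_term P M p (\<lambda>\<omega>. c * Zprod M \<sigma> \<omega>) \<tau> \<noteq> 0} \<subseteq> {\<sigma>}" for p
    by (auto simp: Sp_term_def)
  then have "Sp_term P M p (\<lambda>\<omega>. c * Zprod M \<sigma> \<omega>) summable_on Gam" for p
    by (intro finite_nonzero_values_imp_summable_on) (rule finite_subset, assumption, simp)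
  then show ?thesis
    using L2M_scale[OF Zprod_L2M[OF assms]] by (simp add: SM_space_def Sp_space_def)
qed

text \<open>Only integer orders enter the definition of \<open>SM_space\<close>, but the topology uses the norms of all
  real orders; as \<open>\<lambda>\<^sub>\<sigma> \<ge> 1\<close>, a larger integer order dominates.\<close>

lemma Sp_term_summable:
  assumes "\<xi> \<in> SM_space P M"
  shows "Sp_term P M p \<xi> summable_on Gam"
proof -
  obtain n :: nat where n: "p \<le> real n" using real_arch_simple by blast
  have "Sp_term P M (real n) \<xi> summable_on Gam"
    using assms by (auto simp: SM_space_def Sp_space_def)
  then show ?thesis
  proof (rule summable_on_comparison_test)
    show "Sp_term P M p \<xi> \<sigma> \<le> Sp_term P M (real n) \<xi> \<sigma>" for \<sigma>
      unfolding Sp_term_def using n lam_ge_1[of \<sigma>]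
      by (intro mult_right_mono powr_mono) auto
  qed (simp add: Sp_term_def)
qed

lemma Sp_norm_square:
  assumes "\<xi> \<in> SM_space P M"
  shows "(Sp_term P M p \<xi> has_sum (Sp_norm P M p \<xi>)\<^sup>2) Gam"
proof -
  have "0 \<le> infsum (Sp_term P M p \<xi>) Gam"
    by (rule infsum_nonneg) (simp add: Sp_term_def)
  then show ?thesis
    using Sp_term_summable[OF assms, of p] by (simp add: Sp_norm_def summable_iff_has_sum_infsum)
qed

text \<open>Subtracting \<open>\<xi>\<close> from \<open>t Z\<^sub>\<sigma>\<close> gives the coefficients of \<open>-\<xi>\<close> except at \<open>\<sigma>\<close>, where \<open>t\<close> is added.
  Expanding the square of that one term leaves a cross term, which is controlled because
  \<open>\<lambda>\<^sub>\<sigma>\<^sup>p\<close> times the coefficient of \<open>\<xi>\<close> at \<open>\<sigma>\<close> is at most \<open>\<parallel>\<xi>\<parallel>\<^sub>p\<close>.\<close>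

lemma Sp_norm_scaled_Zprod_diff:
  fixes t :: real
  assumes \<sigma>: "\<sigma> \<in> Gam" and \<xi>: "\<xi> \<in> SM_space P M" and "0 \<le> t"
  shows "Sp_norm P M p (\<lambda>\<omega>. of_real t * Zprod M \<sigma> \<omega> - \<xi> \<omega>)
    \<le> Sp_norm P M p \<xi> + t * lam \<sigma> powr p"
proof -
  define c where "c = (\<lambda>\<tau>. L2_inner P (Zprod M \<tau>) \<xi>)"
  define L where "L = lam \<sigma> powr p"
  define N where "N = Sp_norm P M p \<xi>"
  define g where "g = Sp_term P M p (\<lambda>\<omega>. of_real t * Zprod M \<sigma> \<omega> - \<xi> \<omega>)"
  have N0: "0 \<le> N"
    unfolding N_def Sp_norm_def by (auto intro!: infsum_nonneg simp: Sp_term_def)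
  have L2: "lam \<sigma> powr (2 * p) = L\<^sup>2"
    using lam_ge_1[of \<sigma>] unfolding L_def by (simp add: powr_powr mult.commute flip: powr_numeral)
  have f: "(Sp_term P M p \<xi> has_sum N\<^sup>2) Gam"
    unfolding N_def by (rule Sp_norm_square[OF \<xi>])
  have \<xi>2: "\<xi> \<in> L2_space P"
    using \<xi> L2M_imp_L2_space by (auto simp: SM_space_def Sp_space_def)
  have inner: "L2_inner P (Zprod M \<tau>) (\<lambda>\<omega>. of_real t * Zprod M \<sigma> \<omega> - \<xi> \<omega>)
      = of_real t * (if \<tau> = \<sigma> then 1 else 0) - c \<tau>" if "\<tau> \<in> Gam" for \<tau>
    using L2_inner_scale_diff[OF _ _ \<xi>2, of "Zprod M \<tau>" "Zprod M \<sigma>" "of_real t"] that \<sigma>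
      Zprod_orthonormal[of \<tau> \<sigma>] Zprod_L2M L2M_imp_L2_space
    by (simp add: c_def)
  \<comment> \<open>The correction of the series for \<open>\<xi>\<close>, supported at \<open>\<sigma>\<close>.\<close>
  let ?d = "\<lambda>\<tau>. if \<tau> = \<sigma> then g \<sigma> - Sp_term P M p \<xi> \<sigma> else 0"
  have "(?d has_sum (g \<sigma> - Sp_term P M p \<xi> \<sigma>)) Gam"
    by (rule has_sum_finite_neutralI[of "{\<sigma>}"]) (use \<sigma> in auto)
  from has_sum_add[OF f this]
  have "((\<lambda>\<tau>. Sp_term P M p \<xi> \<tau> + ?d \<tau>) has_sum (N\<^sup>2 + (g \<sigma> - Sp_term P M p \<xi> \<sigma>))) Gam" .
  moreover have "Sp_term P M p \<xi> \<tau> + ?d \<tau> = g \<tau>" if "\<tau> \<in> Gam" for \<tau>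
    using that inner[of \<tau>] by (auto simp: g_def Sp_term_def c_def)
  ultimately have "(g has_sum (N\<^sup>2 + (g \<sigma> - Sp_term P M p \<xi> \<sigma>))) Gam"
    by (simp cong: has_sum_cong)
  then have eq: "infsum g Gam = N\<^sup>2 + (g \<sigma> - Sp_term P M p \<xi> \<sigma>)"
    by (rule infsumI)
  have gs: "g \<sigma> = (L * cmod (of_real t - c \<sigma>))\<^sup>2" and fs: "Sp_term P M p \<xi> \<sigma> = (L * cmod (c \<sigma>))\<^sup>2"
    using inner[OF \<sigma>] L2 by (simp_all add: g_def Sp_term_def c_def power_mult_distrib)
  have "sum (Sp_term P M p \<xi>) {\<sigma>} \<le> N\<^sup>2"
    by (rule finite_sum_le_has_sum[OF f]) (use \<sigma> in \<open>auto simp: Sp_term_def\<close>)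
  then have Lc: "L * cmod (c \<sigma>) \<le> N"
    using fs N0 by (auto intro: power2_le_imp_le)
  have L0: "0 \<le> L" by (simp add: L_def)
  have "L * cmod (of_real t - c \<sigma>) \<le> L * (t + cmod (c \<sigma>))"
    using norm_triangle_ineq4[of "of_real t" "c \<sigma>"] \<open>0 \<le> t\<close> L0
    by (intro mult_left_mono) auto
  then have "g \<sigma> \<le> (t * L + L * cmod (c \<sigma>))\<^sup>2"
    unfolding gs using L0 by (intro power_mono) (auto simp: algebra_simps)
  moreover have "2 * (t * L) * (L * cmod (c \<sigma>)) \<le> 2 * (t * L) * N"
    using Lc \<open>0 \<le> t\<close> L0 by (intro mult_left_mono) auto
  then have "2 * (t * L) * (L * cmod (c \<sigma>)) \<le> 2 * N * (t * L)"
    by (simp add: ac_simps)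
  ultimately have "infsum g Gam \<le> (N + t * L)\<^sup>2"
    unfolding eq fs power2_sum by linarith
  then have "sqrt (infsum g Gam) \<le> N + t * L"
    using N0 L0 \<open>0 \<le> t\<close> by (intro real_le_lsqrt) auto
  then show ?thesis
    by (simp add: Sp_norm_def g_def N_def L_def)
qed

section \<open>Neighbourhoods of the origin\<close>

text \<open>Since \<open>\<lambda>\<^sub>\<sigma> \<ge> 1\<close>, the condition on \<open>t\<close> becomes stronger when \<open>p\<close> grows and \<open>s\<close> shrinks, so the
  property passes to intersections with the maximum of the orders and the minimum of the radii.
  A ball containing the origin has \<open>\<parallel>\<xi>\<parallel>\<^sub>p < \<epsilon>\<close> for its centre \<open>\<xi>\<close>, and half of the gap serves as the
  radius.\<close>

lemma neighbourhood_of_zero_contains_scaled_Zprod: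
  assumes "openin (SM_topology P M) U" "(\<lambda>_. 0) \<in> U"
  shows "\<exists>p\<ge>0. \<exists>s>0. \<forall>\<sigma>\<in>Gam. \<forall>t\<ge>0. t * lam \<sigma> powr p \<le> s \<longrightarrow>
    (\<lambda>\<omega>. of_real t * Zprod M \<sigma> \<omega>) \<in> U" (is "?Q U")
proof -
  let ?B = "{{\<eta> \<in> SM_space P M. Sp_norm P M p (\<lambda>\<omega>. \<eta> \<omega> - \<xi> \<omega>) < \<epsilon>} | \<xi> p \<epsilon>.
        \<xi> \<in> SM_space P M \<and> p \<ge> 0 \<and> \<epsilon> > 0}"
  have "generate_topology_on ?B U"
    using assms(1) unfolding SM_topology_def by (rule openin_topology_generated_by)
  then show ?thesis
    using assms(2)
  proof (induction rule: generate_topology_on.induct)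
    case Empty
    then show ?case by simp
  next
    case (Int a b)
    then have "?Q a" "?Q b" by simp_all
    from \<open>?Q a\<close> obtain p s where ps: "p \<ge> 0" "s > 0"
      and a: "\<forall>\<sigma>\<in>Gam. \<forall>t\<ge>0. t * lam \<sigma> powr p \<le> s \<longrightarrow> (\<lambda>\<omega>. of_real t * Zprod M \<sigma> \<omega>) \<in> a"
      by blast
    from \<open>?Q b\<close> obtain q r where qr: "q \<ge> 0" "r > 0"
      and b: "\<forall>\<sigma>\<in>Gam. \<forall>t\<ge>0. t * lam \<sigma> powr q \<le> r \<longrightarrow> (\<lambda>\<omega>. of_real t * Zprod M \<sigma> \<omega>) \<in> b"
      by blast
    have "\<forall>\<sigma>\<in>Gam. \<forall>t\<ge>0. t * lam \<sigma> powr max p q \<le> min s r \<longrightarrow>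
        (\<lambda>\<omega>. of_real t * Zprod M \<sigma> \<omega>) \<in> a \<inter> b"
    proof (intro ballI allI impI)
      fix \<sigma> :: "nat set" and t :: real
      assume t: "\<sigma> \<in> Gam" "t \<ge> 0" "t * lam \<sigma> powr max p q \<le> min s r"
      have "t * lam \<sigma> powr p \<le> t * lam \<sigma> powr max p q" "t * lam \<sigma> powr q \<le> t * lam \<sigma> powr max p q"
        using t(2) lam_ge_1[of \<sigma>] by (auto intro!: mult_left_mono powr_mono)
      then show "(\<lambda>\<omega>. of_real t * Zprod M \<sigma> \<omega>) \<in> a \<inter> b"
        using t a b by auto
    qed
    moreover have "max p q \<ge> 0" "min s r > 0" using ps qr by auto
    ultimately show ?case by blast
  next
    case (UN K)
    then obtain k where "k \<in> K" "(\<lambda>_. 0) \<in> k" by auto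
    then have "?Q k" by (rule UN.IH)
    with \<open>k \<in> K\<close> show ?case by (meson UnionI)
  next
    case (Basis b)
    then obtain \<xi> p \<epsilon> where b: "b = {\<eta> \<in> SM_space P M. Sp_norm P M p (\<lambda>\<omega>. \<eta> \<omega> - \<xi> \<omega>) < \<epsilon>}"
      and \<xi>: "\<xi> \<in> SM_space P M" and p: "p \<ge> 0"
      by blast
    have "Sp_norm P M p \<xi> = Sp_norm P M p (\<lambda>\<omega>. 0 - \<xi> \<omega>)"
      by (simp add: Sp_norm_def Sp_term_def[abs_def] L2_inner_def)
    also have "\<dots> < \<epsilon>"
      using Basis.prems b by simp
    finally have \<xi>\<epsilon>: "Sp_norm P M p \<xi> < \<epsilon>" .
    have "\<forall>\<sigma>\<in>Gam. \<forall>t\<ge>0. t * lam \<sigma> powr p \<le> (\<epsilon> - Sp_norm P M p \<xi>) / 2 \<longrightarrow>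
        (\<lambda>\<omega>. of_real t * Zprod M \<sigma> \<omega>) \<in> b"
    proof (intro ballI allI impI)
      fix \<sigma> :: "nat set" and t :: real
      assume t: "\<sigma> \<in> Gam" "t \<ge> 0" "t * lam \<sigma> powr p \<le> (\<epsilon> - Sp_norm P M p \<xi>) / 2"
      show "(\<lambda>\<omega>. of_real t * Zprod M \<sigma> \<omega>) \<in> b"
        using scaled_Zprod_SM[OF t(1)] Sp_norm_scaled_Zprod_diff[OF t(1) \<xi> t(2), of p] t(3) \<xi>\<epsilon>
        unfolding b by (auto simp: field_simps)
    qed
    moreover have "(\<epsilon> - Sp_norm P M p \<xi>) / 2 > 0" using \<xi>\<epsilon> by simp
    ultimately show ?case using p by blast
  qed
qed

lemma zero_in_topspace: "(\<lambda>_. 0) \<in> topspace (SM_topology P M)"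
proof -
  have zero: "(\<lambda>_. 0) \<in> SM_space P M"
    using scaled_Zprod_SM[of "{}" 0] by (simp add: Gam_def)
  have "Sp_norm P M 0 (\<lambda>_. 0) = 0"
    by (simp add: Sp_norm_def Sp_term_def[abs_def] L2_inner_def)
  with zero have "(\<lambda>_. 0) \<in> {\<eta> \<in> SM_space P M. Sp_norm P M 0 (\<lambda>\<omega>. \<eta> \<omega> - 0) < 1}" (is "_ \<in> ?W")
    by simp
  moreover have "?W \<in> {{\<eta> \<in> SM_space P M. Sp_norm P M p (\<lambda>\<omega>. \<eta> \<omega> - \<xi> \<omega>) < \<epsilon>} | \<xi> p \<epsilon>.
        \<xi> \<in> SM_space P M \<and> p \<ge> 0 \<and> \<epsilon> > 0}"
    by (rule CollectI, rule exI[of _ "\<lambda>_. 0"], rule exI[of _ 0], rule exI[of _ 1])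
       (simp add: zero)
  ultimately show ?thesis
    unfolding SM_topology_def topology_generated_by_topspace by (rule UnionI[rotated])
qed

end

theorem theorem4p2:
  fixes P :: "'a measure" and M :: "nat \<Rightarrow> 'a \<Rightarrow> real"
    and \<Phi> :: "('a \<Rightarrow> complex) \<Rightarrow> complex"
  assumes "prob_space P"
    and "normal_martingale P M"
    and "chaotic_representation P M"
    and "\<Phi> \<in> SM_dual P M"
  shows "\<exists>C\<ge>0. \<exists>p\<ge>0. \<forall>\<sigma>\<in>Gam. cmod (Fock_transform M \<Phi> \<sigma>) \<le> C * lam \<sigma> powr p"
proof -
  interpret prob_space P by fact
  interpret normal_martingale_space P M by unfold_locales fact
  have "\<forall>a. \<forall>\<xi>\<in>SM_space P M. \<Phi> (\<lambda>\<omega>. a * \<xi> \<omega>) = a * \<Phi> \<xi>"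
    and cont: "continuous_map (SM_topology P M) euclidean \<Phi>"
    using assms(4) unfolding SM_dual_def mem_Collect_eq by - ((elim conjE, assumption)+)
  then have scale: "\<Phi> (\<lambda>\<omega>. a * \<xi> \<omega>) = a * \<Phi> \<xi>" if "\<xi> \<in> SM_space P M" for a \<xi>
    using that by blast
  have Z: "Zprod M \<sigma> \<in> SM_space P M" if "\<sigma> \<in> Gam" for \<sigma>
    using scaled_Zprod_SM[OF that, of 1] by simp
  have \<Phi>0: "\<Phi> (\<lambda>_. 0) = 0"
    using scale[OF Z[of "{}"], of 0] by (simp add: Gam_def)
  define U where "U = {\<xi> \<in> topspace (SM_topology P M). \<Phi> \<xi> \<in> ball 0 1}"
  have U_open: "openin (SM_topology P M) U"
    unfolding U_def by (rule openin_continuous_map_preimage[OF cont]) simp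
  have U_zero: "(\<lambda>_. 0) \<in> U"
    using zero_in_topspace \<Phi>0 by (simp add: U_def)
  obtain p s where "p \<ge> 0" "s > 0"
    and U: "\<forall>\<sigma>\<in>Gam. \<forall>t\<ge>0. t * lam \<sigma> powr p \<le> s \<longrightarrow>
        (\<lambda>\<omega>. of_real t * Zprod M \<sigma> \<omega>) \<in> U"
    using neighbourhood_of_zero_contains_scaled_Zprod[OF U_open U_zero] by blast
  have "cmod (Fock_transform M \<Phi> \<sigma>) \<le> (1 / s) * lam \<sigma> powr p" if \<sigma>: "\<sigma> \<in> Gam" for \<sigma>
  proof -
    define t where "t = s / lam \<sigma> powr p"
    have L: "lam \<sigma> powr p > 0" using lam_ge_1[of \<sigma>] by simp
    then have "t > 0" using \<open>s > 0\<close> by (simp add: t_def)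
    moreover have "t * lam \<sigma> powr p \<le> s" using L by (simp add: t_def)
    ultimately have "(\<lambda>\<omega>. of_real t * Zprod M \<sigma> \<omega>) \<in> U" using U \<sigma> by simp
    then have "cmod (of_real t * \<Phi> (Zprod M \<sigma>)) < 1"
      using scale[OF Z[OF \<sigma>], of "of_real t"] by (simp add: U_def)
    then have "t * cmod (Fock_transform M \<Phi> \<sigma>) < 1"
      using \<open>t > 0\<close> by (simp add: norm_mult Fock_transform_def)
    then show ?thesis
      using L \<open>s > 0\<close> by (simp add: t_def field_simps)
  qed
  moreover have "1 / s \<ge> 0" using \<open>s > 0\<close> by simp
  ultimately show ?thesis
    using \<open>p \<ge> 0\<close> by blast
qed

end
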